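(* Let $\lambda<1$ and let $\mathcal{S}(\lambda)=\bigcup_{\alpha\in(-\pi/2,\pi/2)}\mathcal{S}^*_\alpha(\lambda)$. Then the set of $\gamma\in\mathbb{C}$ such that $J_\gamma[f]\in\mathcal{S}$ for every $f\in\mathcal{S}(\lambda)$ equals $\{\gamma\in\mathbb{C}: |\gamma|\le \frac{1}{2(1-\lambda)}\}$.
   Context: $\mathbb{D}$ is the open unit disk; $\mathcal{A}$ the class of analytic $f$ on $\mathbb{D}$ with $f(0)=0$, $f'(0)=1$; $\mathcal{S}\subset\mathcal{A}$ the univalent functions. For $\alpha\in(-\pi/2,\pi/2)$, $\lambda<1$, $\mathcal{S}^*_\alpha(\lambda)=\{f\in\mathcal{A}: f(z)\neq0 \text{ for } z\ne 0,\ \mathrm{Re}\,(e^{i\alpha}zf'(z)/f(z))>\lambda\cos\alpha \text{ on }\mathbb{D}\}$. For $\gamma\in\mathbb{C}$, $J_\gamma[f](z)=\int_0^z (f(w)/w)^\gamma\,dw$, with the branch of $(f(w)/w)^\gamma$ equal to $1$ at $w=0$. *)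

theory Defs
  imports "HOL-Complex_Analysis.Complex_Analysis"
begin

definition unit_disk :: "complex set" where
  "unit_disk = ball 0 1"

definition classA :: "(complex \<Rightarrow> complex) set" where
  "classA = {f. f holomorphic_on unit_disk \<and> f 0 = 0 \<and> deriv f 0 = 1}"

definition classS :: "(complex \<Rightarrow> complex) set" where
  "classS = {f. f \<in> classA \<and> inj_on f unit_disk}"

definition spiral_class :: "real \<Rightarrow> real \<Rightarrow> (complex \<Rightarrow> complex) set" where
  "spiral_class \<alpha> lam = {f. f \<in> classA \<and> (\<forall>z\<in>unit_disk. z \<noteq> 0 \<longrightarrow> f z \<noteq> 0) \<and>
      (\<forall>z\<in>unit_disk. z \<noteq> 0 \<longrightarrow> Re (exp (\<i> * complex_of_real \<alpha>) * z * deriv f z / f z) > lam * cos \<alpha>)}"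

definition S_lambda :: "real \<Rightarrow> (complex \<Rightarrow> complex) set" where
  "S_lambda lam = (\<Union>\<alpha>\<in>{-(pi/2)<..<pi/2}. spiral_class \<alpha> lam)"

text \<open>The quotient f(w)/w, extended by its value f'(0) = 1 at w = 0.\<close>
definition quot :: "(complex \<Rightarrow> complex) \<Rightarrow> complex \<Rightarrow> complex" where
  "quot f w = (if w = 0 then 1 else f w / w)"

text \<open>The holomorphic logarithm of f(w)/w on the disk vanishing at 0
  (the branch with (f(w)/w)^gamma = 1 at w = 0).\<close>
definition log_quot :: "(complex \<Rightarrow> complex) \<Rightarrow> complex \<Rightarrow> complex" where
  "log_quot f = (SOME g. g holomorphic_on unit_disk \<and> g 0 = 0 \<and>
                    (\<forall>w\<in>unit_disk. exp (g w) = quot f w))"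

definition J_op :: "complex \<Rightarrow> (complex \<Rightarrow> complex) \<Rightarrow> complex \<Rightarrow> complex" where
  "J_op \<gamma> f z = contour_integral (linepath 0 z) (\<lambda>w. exp (\<gamma> * log_quot f w))"

end

theory Submission
  imports Defs
begin

text \<open>
  Let \<open>g = J_op \<gamma> f\<close> with \<open>f\<close> in \<open>spiral_class \<alpha> lam\<close>, and put
  \<open>\<delta> = \<gamma> (1 - lam) e\<^bsup>-i\<alpha>\<^esup> cos \<alpha>\<close>. By the Schwarz lemma
  \<open>z g''/g' = 2\<delta>\<omega>/(1 - \<omega>)\<close> with \<open>|\<omega> z| \<le> |z|\<close>. If \<open>|\<gamma>| < 1/(2(1 - lam))\<close>, then \<open>|\<delta>| < 1/2\<close>,
  and for \<open>\<tau> \<ge> 1\<close> one considers \<open>g z + (\<tau> - 1) z g'(z) / (1 - 2\<delta>)\<close> on the discs \<open>\<tau>|z|\<^sup>2 \<le> R < 1\<close>.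
  The preimages of a fixed value move inward relative to these discs as \<open>\<tau>\<close> grows, so two distinct
  points with the same image persist for all \<open>\<tau>\<close>; but for large \<open>\<tau>\<close> the map is injective.
  The boundary case \<open>|\<gamma>| = 1/(2(1 - lam))\<close> follows from Hurwitz' theorem.

  Conversely, for \<open>f z = z (1 - z)\<^bsup>-2\<delta>/\<gamma>\<^esup>\<close> the function \<open>g\<close> is \<open>(1 - (1 - z)\<^bsup>c\<^esup>)/c\<close> with
  \<open>c = 1 - 2\<delta>\<close>. It is not injective when \<open>2\<pi>i/c\<close> is a difference of two points of
  \<open>log(1 - disc)\<close>, i.e. when \<open>|c - 1| > 1\<close> and \<open>|c + 1| > 1\<close>. As \<open>\<alpha>\<close> varies, \<open>\<delta>\<close> runs through a
  circle with diameter from \<open>0\<close> to \<open>\<gamma> (1 - lam)\<close>, and if \<open>|\<gamma>| > 1/(2(1 - lam))\<close>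
  it contains a point with both properties.
\<close>

section \<open>Functions on convex domains and the Loewner factor\<close>

text \<open>Averaging \<open>f'\<close> over the segment from \<open>x\<close> to \<open>y\<close>
  gives a difference quotient that extends continuously across the diagonal. Pairs of distinct
  points with equal image thus become zeros of a continuous function whose diagonal values are
  known.\<close>

lemma holomorphic_divided_difference:
  fixes f f' :: "complex \<Rightarrow> complex"
  assumes S: "convex S"
    and f: "\<And>z. z \<in> S \<Longrightarrow> (f has_field_derivative f' z) (at z)"
    and cont: "continuous_on S f'"
  obtains D where "continuous_on (S \<times> S) D"
    and "\<And>x y. x \<in> S \<Longrightarrow> y \<in> S \<Longrightarrow> f y - f x = D (x, y) * (y - x)"
    and "\<And>x. x \<in> S \<Longrightarrow> D (x, x) = f' x"
proof
  define D where "D = (\<lambda>(x, y). integral {0..1} (\<lambda>u. f' (linepath x y u)))"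
  have mem: "linepath x y u \<in> S" if "x \<in> S" "y \<in> S" "u \<in> {0..1}" for x y u
    using that S unfolding linepath_def by (auto intro: convexD)
  have "continuous_on ((S \<times> S) \<times> cbox (0::real) 1) (\<lambda>(t, u). f' (linepath (fst t) (snd t) u))"
    unfolding split_beta
    by (rule continuous_on_compose2[OF cont])
      (auto intro!: continuous_intros convexD[OF S] simp: linepath_def[abs_def])
  then show "continuous_on (S \<times> S) D"
    using integral_continuous_on_param[of "S \<times> S" 0 "1::real" "\<lambda>t u. f' (linepath (fst t) (snd t) u)"]
    by (simp add: D_def split_beta)
  show "D (x, x) = f' x" if "x \<in> S" for x
    by (simp add: D_def)
  show "f y - f x = D (x, y) * (y - x)" if xy: "x \<in> S" "y \<in> S" for x y
  proof -
    have "((\<lambda>u. f' (linepath x y u) * (y - x)) has_integral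
        (f (linepath x y 1) - f (linepath x y 0))) {0..1}"
    proof (rule fundamental_theorem_of_calculus)
      fix u :: real assume u: "u \<in> {0..1}"
      have "(linepath x y has_vector_derivative (y - x)) (at u within {0..1})"
        by (rule has_vector_derivative_linepath_within)
      from field_vector_diff_chain_within[OF this
          has_field_derivative_at_within[OF f[OF mem[OF xy u]]]]
      show "((\<lambda>u. f (linepath x y u)) has_vector_derivative f' (linepath x y u) * (y - x)) (at u within {0..1})"
        by (simp add: o_def mult.commute)
    qed simp
    then have "f y - f x = integral {0..1} (\<lambda>u. f' (linepath x y u) * (y - x))"
      by (metis integral_unique linepath_0' linepath_1')
    also have "\<dots> = D (x, y) * (y - x)"
      by (simp add: D_def)
    finally show ?thesis .
  qed
qed

text \<open>\<open>X - \<tau>\<close> equals 2\<delta>(\<tau>w - 1)/(1 - w). The quotient has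
  modulus at most \<tau>, since (\<tau>|1 - w|)^2 - |\<tau>w - 1|^2 = (\<tau> - 1)(\<tau> + 1 -
  2\<tau> Re w) and 2\<tau> Re w \<le> 2 sqrt \<tau> \<le> \<tau> + 1. The strict inequality comes
  from |2\<delta>| < 1.\<close>

lemma loewner_factor_bound:
  fixes \<delta> w :: complex and \<tau> :: real
  assumes \<delta>: "cmod \<delta> < 1/2" and \<tau>: "1 \<le> \<tau>" and w: "cmod w < 1" "\<tau> * (cmod w)\<^sup>2 \<le> 1"
  defines "X \<equiv> 1 - 2 * \<delta> + of_real (\<tau> - 1) * (1 + 2 * \<delta> * w / (1 - w))"
  shows "cmod (X - of_real \<tau>) < \<tau>"
proof -
  have w1: "1 - w \<noteq> 0"
    using w by auto
  have "X - of_real \<tau> = 2 * \<delta> * ((of_real \<tau> * w - 1) / (1 - w))"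
    using w1 by (simp add: X_def field_simps)
  moreover have "cmod ((of_real \<tau> * w - 1) / (1 - w)) \<le> \<tau>"
  proof -
    have "(2 * \<tau> * Re w)\<^sup>2 \<le> 4 * \<tau> * (\<tau> * (cmod w)\<^sup>2)"
      using \<tau> unfolding cmod_power2 by (simp add: power2_eq_square algebra_simps)
    also have "\<dots> \<le> 4 * \<tau> * 1"
      using w \<tau> by (intro mult_left_mono) auto
    also have "\<dots> \<le> (\<tau> + 1)\<^sup>2"
      using sum_squares_ge_zero[of "\<tau> - 1" 0] by (simp add: power2_eq_square algebra_simps)
    finally have "2 * \<tau> * Re w \<le> \<tau> + 1"
      using \<tau> by (meson abs_le_square_iff abs_ge_self abs_of_nonneg order_trans add_nonneg_nonneg zero_le_one power2_le_imp_le)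
    then have "(\<tau> - 1) * (2 * \<tau> * Re w) \<le> (\<tau> - 1) * (\<tau> + 1)"
      using \<tau> by (intro mult_left_mono) auto
    then have "(cmod (of_real \<tau> * w - 1))\<^sup>2 \<le> (\<tau> * cmod (1 - w))\<^sup>2"
      unfolding power_mult_distrib cmod_power2 by (simp add: power2_eq_square algebra_simps)
    then have "cmod (of_real \<tau> * w - 1) \<le> \<tau> * cmod (1 - w)"
      by (rule power2_le_imp_le) (use \<tau> in auto)
    then show ?thesis
      using w1 by (simp add: norm_divide divide_simps)
  qed
  ultimately have "cmod (X - of_real \<tau>) \<le> 2 * cmod \<delta> * \<tau>"
    by (simp add: norm_mult mult_left_mono del: times_divide_eq_right)
  also have "\<dots> < \<tau>"
    using \<delta> \<tau> by (simp add: mult_less_cancel_right1)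
  finally show ?thesis .
qed

text \<open>The boundary circle passes through 0, so inversion maps the disc to the half-plane Re >
  1/(2\<tau>).\<close>

lemma Re_inverse_gt_if_in_disc:
  fixes X :: complex
  assumes "cmod (X - of_real \<tau>) < \<tau>"
  shows "X \<noteq> 0" and "1 < 2 * \<tau> * Re (1 / X)"
proof -
  show X: "X \<noteq> 0"
    using assms by auto
  have "(cmod (X - of_real \<tau>))\<^sup>2 < \<tau>\<^sup>2"
    using assms by (intro power_strict_mono) auto
  then have "(cmod X)\<^sup>2 < 2 * \<tau> * Re X"
    unfolding cmod_power2 by (simp add: power2_eq_square algebra_simps)
  moreover have "(cmod X)\<^sup>2 > 0"
    using X by simp
  ultimately show "1 < 2 * \<tau> * Re (1 / X)"
    by (simp add: Re_divide cmod_power2 field_simps)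
qed

section \<open>Univalence by following a Loewner chain\<close>

text \<open>What the univalence argument uses about \<open>J_op\<close>: \<open>p\<close> is g' and
  \<open>l'\<close> is g''/g'. By \<open>l'_eq\<close>, \<open>z * l' z\<close> is a value of
  2\<delta>w/(1 - w) with |w| \<le> |z|.\<close>

locale subordinate_disc =
  fixes g p l' \<omega> :: "complex \<Rightarrow> complex" and \<delta> :: complex
  assumes g: "\<And>z. z \<in> ball 0 1 \<Longrightarrow> (g has_field_derivative p z) (at z)"
    and p: "\<And>z. z \<in> ball 0 1 \<Longrightarrow> (p has_field_derivative p z * l' z) (at z)"
    and l': "continuous_on (ball 0 1) l'"
    and p0: "p 0 = 1"
    and p_nonzero: "\<And>z. z \<in> ball 0 1 \<Longrightarrow> p z \<noteq> 0"
    and \<omega>: "\<And>z. z \<in> ball 0 1 \<Longrightarrow> cmod (\<omega> z) \<le> cmod z"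
    and l'_eq: "\<And>z. z \<in> ball 0 1 \<Longrightarrow> z * l' z = 2 * \<delta> * \<omega> z / (1 - \<omega> z)"
    and \<delta>: "cmod \<delta> < 1/2"
begin

text \<open>
  With \<open>\<tau> = e\<^bsup>2t\<^esup>\<close> and \<open>z = e\<^bsup>-t\<^esup> \<zeta>\<close>, this is the Loewner chain
  \<open>g(e\<^bsup>-t\<^esup> \<zeta>) + (e\<^bsup>t\<^esup> - e\<^bsup>-t\<^esup>) \<zeta> g'(e\<^bsup>-t\<^esup> \<zeta>) / (1 - 2\<delta>)\<close>
  behind Ahlfors' univalence criterion with constant \<open>c = -2\<delta>\<close>. In the parameter \<open>\<tau>\<close> it is
  affine, so \<open>chain \<tau> z = w\<close> can be solved explicitly for \<open>\<tau>\<close> as a function of \<open>z\<close>.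
\<close>

definition chain :: "real \<Rightarrow> complex \<Rightarrow> complex" where
  "chain \<tau> z = g z + of_real (\<tau> - 1) / (1 - 2 * \<delta>) * (z * p z)"

text \<open>Up to the factor \<open>p z / (1 - 2\<delta>)\<close>, the \<open>z\<close>-derivative of \<open>chain \<tau>\<close>.\<close>

definition factor :: "real \<Rightarrow> complex \<Rightarrow> complex" where
  "factor \<tau> z = 1 - 2 * \<delta> + of_real (\<tau> - 1) * (1 + z * l' z)"

lemma delta_nonzero: "1 - 2 * \<delta> \<noteq> 0"
proof
  assume "1 - 2 * \<delta> = 0"
  then have "cmod (2 * \<delta>) = 1"
    by (metis norm_one right_minus_eq)
  then show False
    using \<delta> by (simp add: norm_mult)
qed

lemma DERIV_times_p: "z \<in> ball 0 1 \<Longrightarrow> ((\<lambda>z. z * p z) has_field_derivative p z * (1 + z * l' z)) (at z)"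
  by (rule derivative_eq_intros p refl | simp add: algebra_simps)+

text \<open>The first claim excludes critical points of \<open>chain \<tau>\<close> where
  \<tau>|z|^2 < 1; the second fixes the direction in which preimages move as \<tau> grows.\<close>

lemma factor_bound:
  assumes "1 \<le> \<tau>" "z \<in> ball 0 1" "\<tau> * (cmod z)\<^sup>2 < 1"
  shows "factor \<tau> z \<noteq> 0" and "1 < 2 * \<tau> * Re (1 / factor \<tau> z)"
proof -
  have \<omega>z: "cmod (\<omega> z) \<le> cmod z" "cmod z < 1"
    using \<omega> assms by auto
  have "\<tau> * (cmod (\<omega> z))\<^sup>2 \<le> \<tau> * (cmod z)\<^sup>2"
    using assms \<omega>z by (intro mult_left_mono power_mono) auto
  then have "cmod (factor \<tau> z - of_real \<tau>) < \<tau>"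
    unfolding factor_def l'_eq[OF assms(2)]
    using assms \<omega>z \<delta> by (intro loewner_factor_bound) linarith+
  then show "factor \<tau> z \<noteq> 0" "1 < 2 * \<tau> * Re (1 / factor \<tau> z)"
    by (rule Re_inverse_gt_if_in_disc)+
qed

text \<open>The preimage \<open>x u\<close> of a fixed value under \<open>chain (s + u)\<close> is a
  differentiable curve starting at \<open>z\<close>. At u = 0 the derivative of (s + u)|x u|^2 is
  |z|^2 (1 - 2s Re (1 / factor s z)), which is negative by \<open>factor_bound\<close>.\<close>

lemma chain_moves_inward:
  assumes s: "1 \<le> s" and z: "z \<in> ball 0 1" "z \<noteq> 0" "s * (cmod z)\<^sup>2 < 1" and e: "0 < e"
  obtains d where "0 < d"
    and "\<And>u. 0 < u \<Longrightarrow> u < d \<Longrightarrow>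
      \<exists>x\<in>ball z e. chain (s + u) x = chain s z \<and> (s + u) * (cmod x)\<^sup>2 \<le> s * (cmod z)\<^sup>2"
proof -
  define b where "b = 1 - 2 * \<delta>"
  have b: "b \<noteq> 0"
    using delta_nonzero by (simp add: b_def)
  \<comment> \<open>\<open>H x\<close> is the value of \<tau> - 1 for which
    \<open>chain \<tau> x = chain s z\<close>; inverting \<open>H\<close> near \<open>z\<close>
    therefore yields the curve of preimages.\<close>
  define H where "H x = b * (chain s z - g x) / (x * p x)" for x
  define U where "U = ball 0 1 - {0::complex}"
  have U: "open U" "z \<in> U"
    using z by (auto simp: U_def)
  have Hz: "H z = of_real (s - 1)"
    using z p_nonzero[of z] b by (simp add: H_def chain_def b_def)
  have H': "(H has_field_derivative
      (b * (0 - p x) * (x * p x) - b * (chain s z - g x) * (p x * (1 + x * l' x))) / ((x * p x) * (x * p x))) (at x)"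
    if "x \<in> U" for x
    unfolding H_def using that p_nonzero[of x] g[of x] DERIV_times_p[of x]
    by (intro DERIV_divide DERIV_cmult DERIV_diff DERIV_const) (auto simp: U_def)
  have Hz': "(H has_field_derivative - factor s z / z) (at z)"
  proof -
    have "(b * (0 - p z) * (z * p z) - b * (chain s z - g z) * (p z * (1 + z * l' z))) / ((z * p z) * (z * p z))
        = - factor s z / z"
      using z p_nonzero[of z] b unfolding chain_def factor_def b_def[symmetric]
      by (simp add: field_simps)
    then show ?thesis
      using H'[OF U(2)] by simp
  qed
  have holH: "H holomorphic_on U"
    using H' U(1) by (auto simp: holomorphic_on_open)
  have nz: "- factor s z / z \<noteq> 0"
    using factor_bound(1)[OF s z(1,3)] z(2) by simp
  obtain r where r: "r > 0" "ball z r \<subseteq> U" "inj_on H (ball z r)"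
    using has_complex_derivative_locally_injective[OF holH U(2,1)] DERIV_imp_deriv[OF Hz'] nz
    by metis
  \<comment> \<open>On \<open>V\<close> the map \<open>H\<close> is injective, and every point found
    there is within \<open>e\<close> of \<open>z\<close>.\<close>
  define V where "V = ball z (min r e)"
  have V: "open V" "z \<in> V" "V \<subseteq> U" "inj_on H V" "V \<subseteq> ball z e"
    using r e unfolding V_def by (auto intro: inj_on_subset)
  have holHV: "H holomorphic_on V"
    using holH V(3) holomorphic_on_subset by blast
  define K where "K = the_inv_into V H"
  have openHV: "open (H ` V)"
    by (rule open_mapping_thm3[OF holHV V(1,4)])
  have K: "(K has_field_derivative inverse (- factor s z / z)) (at (of_real (s - 1)))"
    unfolding Hz[symmetric] K_def
    by (rule has_field_derivative_inverse_strong[OF Hz' nz V(1,2)])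
      (use V(4) holHV in \<open>auto intro: holomorphic_on_imp_continuous_on the_inv_into_f_f\<close>)
  define x where "x u = K (of_real (s - 1 + u))" for u :: real
  have x0: "x 0 = z"
    using the_inv_into_f_f[OF V(4,2)] by (simp add: x_def K_def Hz)
  have x': "(x has_vector_derivative - z / factor s z) (at 0)"
  proof -
    have 1: "((\<lambda>u. of_real (s - 1 + u)) has_vector_derivative (1::complex)) (at 0)"
      by (auto intro!: derivative_eq_intros)
    have 2: "(K has_field_derivative inverse (- factor s z / z)) (at (of_real (s - 1 + 0)))"
      using K by simp
    show ?thesis
      using field_vector_diff_chain_at[OF 1 2] by (simp add: x_def[abs_def] o_def)
  qed
  \<comment> \<open>This is (s + u)|x u|^2, expanded into real and imaginary parts for
    differentiation.\<close>
  define \<phi> where "\<phi> u = (s + u) * ((Re (x u))\<^sup>2 + (Im (x u))\<^sup>2)" for u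
  define X where "X = 1 / factor s z"
  have "(x has_vector_derivative - z * X) (at 0)"
    using x' by (simp add: X_def)
  then have "(\<phi> has_real_derivative (cmod z)\<^sup>2 * (1 - 2 * s * Re X)) (at 0)"
    unfolding \<phi>_def cmod_power2
    by - (rule derivative_eq_intros refl | assumption | simp add: x0 power2_eq_square algebra_simps)+
  moreover have "(cmod z)\<^sup>2 * (1 - 2 * s * Re X) < 0"
    using factor_bound(2)[OF s z(1,3)] z(2) by (simp add: X_def mult_less_0_iff)
  ultimately obtain d1 where d1: "d1 > 0" "\<And>u. 0 < u \<Longrightarrow> u < d1 \<Longrightarrow> \<phi> u < \<phi> 0"
    using DERIV_neg_dec_right[of \<phi> _ 0] by (metis add_0)
  have "of_real (s - 1) \<in> H ` V"
    using V(2) Hz by force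
  then obtain d2 where d2: "d2 > 0" "ball (of_real (s - 1)) d2 \<subseteq> H ` V"
    using openHV open_contains_ball by blast
  show ?thesis
  proof
    show "0 < min d1 d2"
      using d1 d2 by simp
    fix u assume u: "0 < u" "u < min d1 d2"
    have "of_real (s - 1 + u) \<in> ball (of_real (s - 1) :: complex) d2"
      using u by (simp add: dist_norm norm_minus_commute flip: of_real_diff)
    then have HV: "of_real (s - 1 + u) \<in> H ` V"
      using d2 by blast
    have xV: "x u \<in> V"
      unfolding x_def K_def by (rule the_inv_into_into[OF V(4) HV order_refl])
    have Hx: "H (x u) = of_real (s - 1 + u)"
      unfolding x_def K_def by (rule f_the_inv_into_f[OF V(4) HV])
    have "x u \<noteq> 0" "p (x u) \<noteq> 0"
      using xV V(3) p_nonzero by (auto simp: U_def)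
    then have "b * (chain s z - g (x u)) = of_real (s - 1 + u) * (x u * p (x u))"
      using Hx by (simp add: H_def field_simps)
    then have "chain (s + u) (x u) = chain s z"
      using b unfolding chain_def[of "s + u"] b_def[symmetric] by (simp add: field_simps)
    moreover have "(s + u) * (cmod (x u))\<^sup>2 \<le> s * (cmod z)\<^sup>2"
      using d1(2)[of u] u by (simp add: \<phi>_def x0 cmod_power2)
    ultimately show "\<exists>x\<in>ball z e. chain (s + u) x = chain s z \<and> (s + u) * (cmod x)\<^sup>2 \<le> s * (cmod z)\<^sup>2"
      using xV V(5) by blast
  qed
qed

text \<open>A maximality argument: the coincidences of the chain form a compact set
  \<open>T\<close>. At one with largest \<tau> both points can be moved inward for a slightly larger
  \<tau> while staying distinct, a contradiction.\<close>

lemma inj_on_disc: "inj_on g (ball 0 1)"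
proof (rule inj_onI, rule ccontr)
  fix z1 z2 assume z: "z1 \<in> ball 0 1" "z2 \<in> ball 0 1" "g z1 = g z2" "z1 \<noteq> z2"
  \<comment> \<open>Both points satisfy \<tau>|z|^2 \<le> R at \<tau> = 1. As R < 1, this condition
    keeps all later points in a fixed compact part of the disc.\<close>
  define R where "R = max ((cmod z1)\<^sup>2) ((cmod z2)\<^sup>2)"
  have R: "0 \<le> R" "R < 1"
    using z by (auto simp: R_def abs_square_less_1 le_max_iff_disj)
  define b where "b = 1 - 2 * \<delta>"
  have b: "b \<noteq> 0"
    using delta_nonzero by (simp add: b_def)
  have cont_p: "continuous_on (ball 0 1) p"
    using p by (intro continuous_at_imp_continuous_on ballI DERIV_isCont) blast
  obtain A where A: "continuous_on (ball 0 1 \<times> ball 0 1) A"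
    "\<And>x y. x \<in> ball 0 1 \<Longrightarrow> y \<in> ball 0 1 \<Longrightarrow> g y - g x = A (x, y) * (y - x)"
    "\<And>x. x \<in> ball 0 1 \<Longrightarrow> A (x, x) = p x"
    using holomorphic_divided_difference[OF convex_ball g cont_p] by blast
  obtain B where B: "continuous_on (ball 0 1 \<times> ball 0 1) B"
    "\<And>x y. x \<in> ball 0 1 \<Longrightarrow> y \<in> ball 0 1 \<Longrightarrow> y * p y - x * p x = B (x, y) * (y - x)"
    "\<And>x. x \<in> ball 0 1 \<Longrightarrow> B (x, x) = p x * (1 + x * l' x)"
    by (rule holomorphic_divided_difference[OF convex_ball DERIV_times_p])
      (use cont_p l' in \<open>auto intro!: continuous_intros\<close>)
  \<comment> \<open>This is \<open>b\<close> times the divided difference of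
    \<open>chain \<tau>\<close>. It does not vanish on the diagonal (\<open>D_diag\<close>), so
    zeros of \<open>D\<close> are genuine coincidences and limits of them cannot merge.\<close>
  define D where "D \<tau> x y = b * A (x, y) + of_real (\<tau> - 1) * B (x, y)" for \<tau> x y
  have D: "b * (chain \<tau> y - chain \<tau> x) = D \<tau> x y * (y - x)"
    if "x \<in> ball 0 1" "y \<in> ball 0 1" for \<tau> x y
  proof -
    have "b * (chain \<tau> y - chain \<tau> x) = b * (g y - g x) + of_real (\<tau> - 1) * (y * p y - x * p x)"
      using b unfolding chain_def b_def[symmetric] by (simp add: field_simps)
    also have "\<dots> = D \<tau> x y * (y - x)"
      unfolding A(2)[OF that] B(2)[OF that] D_def by (simp add: algebra_simps)
    finally show ?thesis .
  qed
  have in_ball: "x \<in> ball 0 1 \<and> \<tau> * (cmod x)\<^sup>2 < 1" if "1 \<le> \<tau>" "\<tau> * (cmod x)\<^sup>2 \<le> R" for \<tau> x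
  proof -
    have "(cmod x)\<^sup>2 \<le> \<tau> * (cmod x)\<^sup>2"
      using that(1) by (simp add: mult_le_cancel_right1)
    then have "(cmod x)\<^sup>2 < 1" "\<tau> * (cmod x)\<^sup>2 < 1"
      using that R by linarith+
    then show ?thesis
      by (simp add: abs_square_less_1)
  qed
  have D_diag: "D \<tau> x x \<noteq> 0" if "1 \<le> \<tau>" "\<tau> * (cmod x)\<^sup>2 \<le> R" for \<tau> x
  proof -
    have "D \<tau> x x = p x * factor \<tau> x"
      using A(3) B(3) in_ball[OF that] by (simp add: D_def factor_def b_def algebra_simps)
    then show ?thesis
      using p_nonzero in_ball[OF that] factor_bound(1)[OF that(1)] by auto
  qed
  \<comment> \<open>For large \<tau> both points are near 0, where \<open>A\<close> and
    \<open>B\<close> are close to \<open>p 0 = 1\<close>. There (\<tau> - 1)B dominates bA: from |A|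
    < 2 and |B| > 1/2, a zero of \<open>D\<close> forces \<tau> \<le> 1 + 4|b|.\<close>
  obtain N where N: "\<And>\<tau> x y. 1 \<le> \<tau> \<Longrightarrow> \<tau> * (cmod x)\<^sup>2 \<le> R \<Longrightarrow> \<tau> * (cmod y)\<^sup>2 \<le> R \<Longrightarrow> D \<tau> x y = 0 \<Longrightarrow> \<tau> \<le> N"
  proof -
    have open2: "open (ball 0 1 \<times> ball 0 1 :: (complex \<times> complex) set)"
      by (simp add: open_Times)
    have "isCont A (0, 0)" "isCont B (0, 0)"
      using A(1) B(1) by (auto intro: continuous_on_interior simp: interior_open[OF open2])
    then have lim: "((\<lambda>t. cmod (A t)) \<longlongrightarrow> cmod (A (0, 0))) (nhds (0, 0))"
      "((\<lambda>t. cmod (B t)) \<longlongrightarrow> cmod (B (0, 0))) (nhds (0, 0))"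
      by (simp_all add: isCont_def tendsto_at_iff_tendsto_nhds tendsto_norm)
    have "\<forall>\<^sub>F t in nhds (0, 0). cmod (A t) < 2" "\<forall>\<^sub>F t in nhds (0, 0). 1/2 < cmod (B t)"
      using order_tendstoD(2)[OF lim(1), of 2] order_tendstoD(1)[OF lim(2), of "1/2"]
        A(3)[of 0] B(3)[of 0] p0 by simp_all
    then have "\<forall>\<^sub>F t in nhds (0, 0). cmod (A t) < 2 \<and> 1/2 < cmod (B t)"
      by (rule eventually_conj)
    then obtain h where h: "h > 0" "\<And>t. dist t (0, 0) < h \<Longrightarrow> cmod (A t) < 2 \<and> 1/2 < cmod (B t)"
      unfolding eventually_nhds_metric by blast
    have "D \<tau> x y \<noteq> 0" if \<tau>: "max (4 * R / h\<^sup>2) (1 + 4 * cmod b) < \<tau>" "1 \<le> \<tau>"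
      "\<tau> * (cmod x)\<^sup>2 \<le> R" "\<tau> * (cmod y)\<^sup>2 \<le> R" for \<tau> x y
    proof
      assume D0: "D \<tau> x y = 0"
      have small: "cmod x < h / 2" if "\<tau> * (cmod x)\<^sup>2 \<le> R" for x
      proof -
        have "\<tau> * (cmod x)\<^sup>2 < \<tau> * (h / 2)\<^sup>2"
          by (rule le_less_trans[OF that]) (use \<tau>(1) h(1) in \<open>simp add: pos_divide_less_eq power_divide\<close>)
        then have "(cmod x)\<^sup>2 < (h / 2)\<^sup>2"
          using \<tau>(2) by (simp add: mult_less_cancel_left_pos del: power_divide)
        then show ?thesis
          using h(1) by (rule_tac power2_less_imp_less) auto
      qed
      have "dist (x, y) (0, 0) \<le> cmod x + cmod y"
        by (simp add: dist_Pair_Pair sqrt_sum_squares_le_sum)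
      then have AB: "cmod (A (x, y)) < 2" "1/2 < cmod (B (x, y))"
        using h(2)[of "(x, y)"] small[OF \<tau>(3)] small[OF \<tau>(4)] by auto
      have "(\<tau> - 1) * (1/2) \<le> (\<tau> - 1) * cmod (B (x, y))"
        using AB \<tau> by (intro mult_left_mono) auto
      also have "\<dots> = cmod (of_real (\<tau> - 1) * B (x, y))"
        using \<tau>(2) unfolding norm_mult norm_of_real by simp
      also have "of_real (\<tau> - 1) * B (x, y) = - (b * A (x, y))"
        using D0 by (simp add: D_def add_eq_0_iff)
      also have "cmod (- (b * A (x, y))) \<le> cmod b * 2"
        using AB by (simp add: norm_mult mult_left_mono)
      finally show False
        using \<tau>(1) by simp
    qed
    then show ?thesis
      using that by (meson not_less)
  qed
  \<comment> \<open>A compact box containing every coincidence: \<open>N\<close> bounds \<tau>, and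
    \<tau> \<ge> 1 gives |x| \<le> sqrt R. By \<open>T_iff\<close>, restricting to it loses
    nothing.\<close>
  define C where "C = {1..max 1 N} \<times> cball (0::complex) (sqrt R) \<times> cball (0::complex) (sqrt R)"
  define T where "T = {t \<in> C. fst t * (cmod (fst (snd t)))\<^sup>2 \<le> R \<and> fst t * (cmod (snd (snd t)))\<^sup>2 \<le> R
      \<and> D (fst t) (fst (snd t)) (snd (snd t)) = 0}"
  have T_iff: "(\<tau>, x, y) \<in> T \<longleftrightarrow> 1 \<le> \<tau> \<and> \<tau> * (cmod x)\<^sup>2 \<le> R \<and> \<tau> * (cmod y)\<^sup>2 \<le> R \<and> D \<tau> x y = 0"
    for \<tau> x y
  proof -
    have "cmod x \<le> sqrt R" if "1 \<le> \<tau>" "\<tau> * (cmod x)\<^sup>2 \<le> R" for x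
    proof (rule real_le_rsqrt)
      show "(cmod x)\<^sup>2 \<le> R"
        using that by (smt (verit) mult_le_cancel_right1 zero_le_power2)
    qed
    then show ?thesis
      using N[of \<tau> x y] by (auto simp: T_def C_def max_def)
  qed
  have "compact C"
    unfolding C_def by (intro compact_Times compact_Icc compact_cball)
  have Csub: "snd ` C \<subseteq> ball 0 1 \<times> ball 0 1"
    using le_less_trans[of _ "sqrt R" 1] R(2) by (auto simp: C_def)
  have contD: "continuous_on C (\<lambda>t. D (fst t) (fst (snd t)) (snd (snd t)))"
    unfolding D_def prod.collapse
    by (intro continuous_intros continuous_on_compose2[OF A(1)] continuous_on_compose2[OF B(1)] Csub)
  have "closed {t \<in> C. fst t * (cmod (fst (snd t)))\<^sup>2 \<le> R}" "closed {t \<in> C. fst t * (cmod (snd (snd t)))\<^sup>2 \<le> R}"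
    "closed {t \<in> C. D (fst t) (fst (snd t)) (snd (snd t)) = 0}"
    using compact_imp_closed[OF \<open>compact C\<close>]
    by (auto intro!: continuous_on_closed_Collect_le continuous_closed_preimage_constant contD continuous_intros)
  then have "closed ({t \<in> C. fst t * (cmod (fst (snd t)))\<^sup>2 \<le> R} \<inter> {t \<in> C. fst t * (cmod (snd (snd t)))\<^sup>2 \<le> R}
      \<inter> {t \<in> C. D (fst t) (fst (snd t)) (snd (snd t)) = 0})"
    by (intro closed_Int)
  also have "\<dots> = T"
    by (auto simp: T_def)
  finally have "compact (C \<inter> T)"
    using \<open>compact C\<close> by (rule compact_Int_closed[rotated])
  then have "compact T"
    by (simp add: T_def Int_absorb1 subset_iff Int_def conj_ac cong: conj_cong)
  have "D 1 z1 z2 * (z2 - z1) = 0"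
    using D[OF z(1,2), of 1] z(3) by (simp add: chain_def)
  then have "(1, z1, z2) \<in> T"
    using z(4) by (simp add: T_iff R_def)
  then have "T \<noteq> {}"
    by blast
  then obtain t where t: "t \<in> T" "\<And>t'. t' \<in> T \<Longrightarrow> fst t' \<le> fst t"
    using continuous_attains_sup[OF \<open>compact T\<close> _ continuous_on_fst[OF continuous_on_id]] by blast
  obtain s x y where [simp]: "t = (s, x, y)"
    by (cases t) auto
  have s: "1 \<le> s" and x: "s * (cmod x)\<^sup>2 \<le> R" and y: "s * (cmod y)\<^sup>2 \<le> R" and Dxy: "D s x y = 0"
    using t(1) by (auto simp: T_iff)
  have "x \<noteq> y"
    using D_diag[OF s x] Dxy by auto
  have eq: "chain s x = chain s y"
    using D[of x y s] in_ball[OF s x] in_ball[OF s y] Dxy b by simp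
  \<comment> \<open>With half the distance as radius, the balls around \<open>x\<close> and
    \<open>y\<close> are disjoint, so the moved points remain distinct.\<close>
  define e where "e = dist x y / 2"
  have e: "e > 0"
    using \<open>x \<noteq> y\<close> by (simp add: e_def)
  have move: "\<exists>d>0. \<forall>u. 0 < u \<longrightarrow> u < d \<longrightarrow>
      (\<exists>v\<in>ball w e. chain (s + u) v = chain s w \<and> (s + u) * (cmod v)\<^sup>2 \<le> R)"
    if w: "s * (cmod w)\<^sup>2 \<le> R" for w
  proof (cases "w = 0")
    \<comment> \<open>Every \<open>chain \<tau>\<close> takes the value \<open>g 0\<close> at 0, so
      0 itself serves as the moved point.\<close>
    case True
    then show ?thesis
      using e R by (intro exI[of _ 1]) (auto simp: chain_def intro!: bexI[of _ 0])
  next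
    case False
    obtain d where "0 < d" "\<And>u. 0 < u \<Longrightarrow> u < d \<Longrightarrow>
      \<exists>v\<in>ball w e. chain (s + u) v = chain s w \<and> (s + u) * (cmod v)\<^sup>2 \<le> s * (cmod w)\<^sup>2"
      using chain_moves_inward[OF s _ False _ e] in_ball[OF s w] by blast
    then show ?thesis
      using w by (meson order_trans)
  qed
  obtain d1 where d1: "d1 > 0" "\<And>u. 0 < u \<Longrightarrow> u < d1 \<Longrightarrow>
      \<exists>v\<in>ball x e. chain (s + u) v = chain s x \<and> (s + u) * (cmod v)\<^sup>2 \<le> R"
    using move[OF x] by blast
  obtain d2 where d2: "d2 > 0" "\<And>u. 0 < u \<Longrightarrow> u < d2 \<Longrightarrow>
      \<exists>v\<in>ball y e. chain (s + u) v = chain s y \<and> (s + u) * (cmod v)\<^sup>2 \<le> R"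
    using move[OF y] by blast
  define u where "u = min d1 d2 / 2"
  have u: "0 < u" "u < d1" "u < d2"
    using d1(1) d2(1) by (auto simp: u_def)
  obtain x' where x': "x' \<in> ball x e" "chain (s + u) x' = chain s x" "(s + u) * (cmod x')\<^sup>2 \<le> R"
    using d1(2) u by blast
  obtain y' where y': "y' \<in> ball y e" "chain (s + u) y' = chain s y" "(s + u) * (cmod y')\<^sup>2 \<le> R"
    using d2(2) u by blast
  have su: "1 \<le> s + u"
    using s u by simp
  have "x' \<noteq> y'"
  proof
    assume "x' = y'"
    then have "dist x y < e + e"
      using x'(1) y'(1) dist_triangle_less_add[of x y' e y e] by (simp add: dist_commute)
    then show False
      by (simp add: e_def)
  qed
  then have "D (s + u) x' y' = 0"
    using D[of x' y' "s + u"] in_ball[OF su x'(3)] in_ball[OF su y'(3)] x'(2) y'(2) eq by simp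
  then have "(s + u, x', y') \<in> T"
    using su x' y' by (simp add: T_iff)
  then show False
    using t(2) u by force
qed

end

section \<open>The operator \<open>J_op\<close>\<close>

lemma unit_disk_simps [simp]: "open unit_disk" "convex unit_disk" "0 \<in> unit_disk"
  by (auto simp: unit_disk_def)

text \<open>Justifies the choice in the definition: \<open>quot f\<close> is holomorphic by removal
  of the singularity and has no zero, hence has a logarithm \<open>k\<close> on the contractible
  disc. Subtracting \<open>k 0\<close> normalises it, since exp (k 0) = 1.\<close>

lemma log_quot:
  assumes f: "f \<in> classA" and nz: "\<forall>z\<in>unit_disk. z \<noteq> 0 \<longrightarrow> f z \<noteq> 0"
  shows "log_quot f holomorphic_on unit_disk" and "log_quot f 0 = 0"
    and "\<And>w. w \<in> unit_disk \<Longrightarrow> exp (log_quot f w) = quot f w"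
proof -
  have "(\<lambda>z. if z = 0 then deriv f 0 else (f z - f 0) / (z - 0)) holomorphic_on unit_disk"
    using f by (intro pole_lemma_open) (auto simp: classA_def unit_disk_def)
  moreover have "(\<lambda>z. if z = 0 then deriv f 0 else (f z - f 0) / (z - 0)) = quot f"
    using f by (auto simp: quot_def classA_def)
  ultimately have hol: "quot f holomorphic_on unit_disk"
    by simp
  have contr: "contractible unit_disk"
    by (simp add: unit_disk_def convex_imp_contractible)
  obtain k where k: "k holomorphic_on unit_disk" "\<And>z. z \<in> unit_disk \<Longrightarrow> quot f z = exp (k z)"
  proof (rule contractible_imp_holomorphic_log[OF hol contr])
    show "quot f z \<noteq> 0" if "z \<in> unit_disk" for z
      using that nz by (simp add: quot_def)
  qed blast
  have "exp (k 0) = 1"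
    using k(2)[of 0] by (simp add: quot_def unit_disk_def)
  then have "(\<lambda>z. k z - k 0) holomorphic_on unit_disk \<and> k 0 - k 0 = 0 \<and>
      (\<forall>w\<in>unit_disk. exp (k w - k 0) = quot f w)"
    using k by (auto intro!: holomorphic_intros simp: exp_diff)
  then have "log_quot f holomorphic_on unit_disk \<and> log_quot f 0 = 0 \<and>
      (\<forall>w\<in>unit_disk. exp (log_quot f w) = quot f w)"
    unfolding log_quot_def
    by (rule someI[where P = "\<lambda>g. g holomorphic_on unit_disk \<and> g 0 = 0 \<and>
      (\<forall>w\<in>unit_disk. exp (g w) = quot f w)"])
  then show "log_quot f holomorphic_on unit_disk" "log_quot f 0 = 0"
    "\<And>w. w \<in> unit_disk \<Longrightarrow> exp (log_quot f w) = quot f w"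
    by auto
qed

lemma DERIV_unique_primitive:
  fixes F G :: "complex \<Rightarrow> complex"
  assumes S: "convex S" "open S" "a \<in> S" "z \<in> S" and "F a = G a"
    and "\<And>x. x \<in> S \<Longrightarrow> (F has_field_derivative h x) (at x)"
    and "\<And>x. x \<in> S \<Longrightarrow> (G has_field_derivative h x) (at x)"
  shows "F z = G z"
proof -
  have "((\<lambda>x. F x - G x) has_field_derivative 0) (at x within S)" if "x \<in> S" for x
    using DERIV_diff[OF assms(6,7)] that by (simp add: has_field_derivative_at_within)
  then have "\<exists>c. \<forall>x\<in>S. F x - G x = c"
    by (rule has_field_derivative_zero_constant[OF S(1)])
  then have "F z - G z = F a - G a"
    using S(3,4) by auto
  then show ?thesis
    using assms(5) by simp
qed

text \<open>Differentiating the common exponential shows that both logarithms have the same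
  derivative. This identifies the chosen branch for an explicit \<open>f\<close>.\<close>

lemma log_quot_unique:
  assumes f: "f \<in> classA" and nz: "\<forall>z\<in>unit_disk. z \<noteq> 0 \<longrightarrow> f z \<noteq> 0"
    and k: "k holomorphic_on unit_disk" "k 0 = 0" "\<And>w. w \<in> unit_disk \<Longrightarrow> exp (k w) = quot f w"
    and z: "z \<in> unit_disk"
  shows "log_quot f z = k z"
proof (rule DERIV_unique_primitive[of unit_disk 0 z "log_quot f" k "deriv k"])
  note L = log_quot[OF f nz]
  show "convex unit_disk" "open unit_disk" "0 \<in> unit_disk" "z \<in> unit_disk" "log_quot f 0 = k 0"
    using z k L by (auto simp: unit_disk_def)
  fix x assume x: "x \<in> unit_disk"
  show dk: "(k has_field_derivative deriv k x) (at x)"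
    by (rule holomorphic_derivI[OF k(1) unit_disk_simps(1) x])
  have dL: "(log_quot f has_field_derivative deriv (log_quot f) x) (at x)"
    by (rule holomorphic_derivI[OF L(1) unit_disk_simps(1) x])
  have "exp (k w) = exp (log_quot f w)" if "w \<in> unit_disk" for w
    using k(3) L(3) that by simp
  then have "((\<lambda>w. exp (log_quot f w)) has_field_derivative exp (k x) * deriv k x) (at x)"
    by (rule has_field_derivative_transform_within_open[OF DERIV_chain2[OF DERIV_exp dk] unit_disk_simps(1) x])
  moreover have "((\<lambda>w. exp (log_quot f w)) has_field_derivative exp (log_quot f x) * deriv (log_quot f) x) (at x)"
    by (rule DERIV_chain2[OF DERIV_exp dL])
  ultimately have "exp (k x) * deriv k x = exp (log_quot f x) * deriv (log_quot f) x"
    by (rule DERIV_unique)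
  then have "deriv (log_quot f) x = deriv k x"
    using k(3)[OF x] L(3)[OF x] exp_not_eq_zero[of "k x"] by simp
  then show "(log_quot f has_field_derivative deriv k x) (at x)"
    using dL by simp
qed

lemma J_op:
  assumes L: "log_quot f holomorphic_on unit_disk"
  shows J_op_0: "J_op \<gamma> f 0 = 0"
    and DERIV_J_op: "\<And>z. z \<in> unit_disk \<Longrightarrow> (J_op \<gamma> f has_field_derivative exp (\<gamma> * log_quot f z)) (at z)"
proof -
  show "J_op \<gamma> f 0 = 0"
    by (simp add: J_op_def)
  have "(\<lambda>w. exp (\<gamma> * log_quot f w)) holomorphic_on unit_disk"
    by (intro holomorphic_intros L)
  then obtain F where F: "\<And>x. x \<in> unit_disk \<Longrightarrow>
      (F has_field_derivative exp (\<gamma> * log_quot f x)) (at x within unit_disk)"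
    using holomorphic_convex_primitive'[of unit_disk] by (auto simp: unit_disk_def)
  have J: "F z - F 0 = J_op \<gamma> f z" if "z \<in> unit_disk" for z
  proof -
    have "path_image (linepath 0 z) \<subseteq> unit_disk"
      using that closed_segment_subset[of 0 "ball 0 1" z] by (simp add: unit_disk_def)
    then have "((\<lambda>w. exp (\<gamma> * log_quot f w)) has_contour_integral
        (F (pathfinish (linepath 0 z)) - F (pathstart (linepath 0 z)))) (linepath 0 z)"
      by (intro contour_integral_primitive[where S = unit_disk] F valid_path_linepath)
    then show ?thesis
      by (simp add: J_op_def contour_integral_unique)
  qed
  fix z assume z: "z \<in> unit_disk"
  have "(F has_field_derivative exp (\<gamma> * log_quot f z)) (at z)"
    using F[OF z] by (simp add: at_within_open[OF z])
  then have "((\<lambda>z. F z - F 0) has_field_derivative exp (\<gamma> * log_quot f z)) (at z)"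
    by (rule DERIV_diff[OF _ DERIV_const, of _ _ _ _ "F 0", unfolded diff_0_right])
  then show "(J_op \<gamma> f has_field_derivative exp (\<gamma> * log_quot f z)) (at z)"
    by (rule has_field_derivative_transform_within_open[OF _ unit_disk_simps(1) z]) (rule J)
qed

lemma J_op_in_classA:
  assumes "f \<in> classA" and "\<forall>z\<in>unit_disk. z \<noteq> 0 \<longrightarrow> f z \<noteq> 0"
  shows "J_op \<gamma> f \<in> classA"
proof -
  note L = log_quot[OF assms]
  have "J_op \<gamma> f holomorphic_on unit_disk"
    using DERIV_J_op[OF L(1)] holomorphic_on_open[of unit_disk "J_op \<gamma> f"] by auto
  moreover have "deriv (J_op \<gamma> f) 0 = 1"
    using DERIV_imp_deriv[OF DERIV_J_op[OF L(1), of 0]] L(2) by (simp add: unit_disk_def)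
  ultimately show ?thesis
    using J_op_0[OF L(1)] by (simp add: classA_def)
qed

section \<open>Univalence in the closed disc of exponents\<close>

text \<open>The spiral condition gives a function \<open>P\<close> of positive real part with P 0 =
  1, and its Cayley transform is the \<omega> of the locale. The strict bound on \<gamma> provides
  |\<delta>| < 1/2.\<close>

lemma inj_on_J_op_less:
  assumes lam: "lam < 1" and \<alpha>: "\<alpha> \<in> {-(pi/2)<..<pi/2}" and f: "f \<in> spiral_class \<alpha> lam"
    and \<gamma>: "cmod \<gamma> < 1 / (2 * (1 - lam))"
  shows "inj_on (J_op \<gamma> f) unit_disk"
proof -
  have fA: "f \<in> classA" and nz: "\<forall>z\<in>unit_disk. z \<noteq> 0 \<longrightarrow> f z \<noteq> 0"
    and re: "\<And>z. z \<in> unit_disk \<Longrightarrow> z \<noteq> 0 \<Longrightarrow>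
      Re (exp (\<i> * complex_of_real \<alpha>) * z * deriv f z / f z) > lam * cos \<alpha>"
    using f by (auto simp: spiral_class_def)
  note L = log_quot[OF fA nz]
  define L' where "L' = deriv (log_quot f)"
  have DL: "(log_quot f has_field_derivative L' z) (at z)" if "z \<in> unit_disk" for z
    unfolding L'_def by (rule holomorphic_derivI[OF L(1) _ that]) simp
  have holL': "L' holomorphic_on unit_disk"
    unfolding L'_def by (rule holomorphic_deriv[OF L(1)]) simp
  have cos: "cos \<alpha> > 0"
    using \<alpha> by (intro cos_gt_zero_pi) auto
  define m where "m = (1 - lam) * cos \<alpha>"
  have m: "m > 0"
    using cos lam by (simp add: m_def)
  define E where "E = exp (\<i> * complex_of_real \<alpha>)"
  have E: "E \<noteq> 0" "cmod E = 1" "Re E = cos \<alpha>"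
    by (auto simp: E_def Re_exp)
  \<comment> \<open>This is (E z f'/f - lam cos \<alpha> - \<i> sin \<alpha>)/m away from 0, because
    E - lam cos \<alpha> - \<i> sin \<alpha> = m.\<close>
  define P where "P z = 1 + E * (z * L' z) / of_real m" for z
  have log_deriv: "z * deriv f z / f z = 1 + z * L' z" if z: "z \<in> unit_disk" "z \<noteq> 0" for z
  proof -
    have fexp: "x * exp (log_quot f x) = f x" if "x \<in> unit_disk" for x
      using L(3)[OF that] fA by (auto simp: quot_def classA_def)
    have "((\<lambda>x. x * exp (log_quot f x)) has_field_derivative exp (log_quot f z) * (1 + z * L' z)) (at z)"
      by (auto intro!: derivative_eq_intros DL z simp: algebra_simps)
    then have "(f has_field_derivative exp (log_quot f z) * (1 + z * L' z)) (at z)"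
      by (rule has_field_derivative_transform_within_open[OF _ unit_disk_simps(1) z(1)]) (rule fexp)
    then have "deriv f z = exp (log_quot f z) * (1 + z * L' z)"
      by (rule DERIV_imp_deriv)
    then show ?thesis
      using fexp[OF z(1)] z(2) by (simp flip: fexp[OF z(1)])
  qed
  have ReP: "Re (P z) > 0" if z: "z \<in> unit_disk" for z
  proof (cases "z = 0")
    case False
    have "Re (E * (1 + z * L' z)) > lam * cos \<alpha>"
      using re[OF z False] unfolding log_deriv[OF z False, symmetric] E_def
      by (simp only: mult.assoc times_divide_eq_right)
    moreover have "Re (E * (1 + z * L' z)) = cos \<alpha> + Re (E * (z * L' z))"
      by (simp add: distrib_left E)
    ultimately have "m + Re (E * (z * L' z)) > 0"
      by (simp add: m_def algebra_simps)
    moreover have "Re (P z) = (m + Re (E * (z * L' z))) / m"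
      using m by (simp add: P_def add_divide_distrib Re_divide_of_real)
    ultimately show ?thesis
      using m by simp
  qed (simp add: P_def)
  have P1: "P z + 1 \<noteq> 0" if "z \<in> unit_disk" for z
    using ReP[OF that] by (metis Re_complex_of_real add_eq_0_iff2 linorder_not_less neg_le_0_iff_le of_real_1 uminus_complex.simps(1) zero_le_one)
  define \<omega> where "\<omega> z = (P z - 1) / (P z + 1)" for z
  have hol\<omega>: "\<omega> holomorphic_on ball 0 1"
    unfolding \<omega>_def P_def using P1 m holL'
    by (auto intro!: holomorphic_intros simp: P_def unit_disk_def)
  have \<omega>1: "cmod (\<omega> z) < 1" if "cmod z < 1" for z
  proof -
    have z: "z \<in> unit_disk"
      using that by (simp add: unit_disk_def)
    have "(cmod (P z - 1))\<^sup>2 < (cmod (P z + 1))\<^sup>2"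
      unfolding cmod_power2 using ReP[OF z] by (simp add: power2_eq_square algebra_simps)
    then have "cmod (P z - 1) < cmod (P z + 1)"
      by (rule power2_less_imp_less) simp
    then show ?thesis
      using P1[OF z] by (simp add: \<omega>_def norm_divide)
  qed
  have \<omega>: "cmod (\<omega> z) \<le> cmod z" if "z \<in> ball 0 1" for z
    using that by (intro Schwarz_Lemma(1)[OF hol\<omega>] \<omega>1) (auto simp: \<omega>_def P_def)
  \<comment> \<open>Chosen so that \<open>\<gamma> * (z * L' z)\<close> is \<delta>(P z - 1), where
    P - 1 = 2\<omega>/(1 - \<omega>).\<close>
  define \<delta> where "\<delta> = \<gamma> * of_real m / E"
  interpret subordinate_disc "J_op \<gamma> f" "\<lambda>z. exp (\<gamma> * log_quot f z)" "\<lambda>z. \<gamma> * L' z" \<omega> \<delta>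
  proof
    fix z :: complex assume z: "z \<in> ball 0 1"
    then have zu: "z \<in> unit_disk"
      by (simp add: unit_disk_def)
    show "(J_op \<gamma> f has_field_derivative exp (\<gamma> * log_quot f z)) (at z)"
      by (rule DERIV_J_op[OF L(1) zu])
    show "((\<lambda>z. exp (\<gamma> * log_quot f z)) has_field_derivative exp (\<gamma> * log_quot f z) * (\<gamma> * L' z)) (at z)"
      by (auto intro!: derivative_eq_intros DL zu)
    show "exp (\<gamma> * log_quot f z) \<noteq> 0"
      by simp
    show "cmod (\<omega> z) \<le> cmod z"
      by (rule \<omega>[OF z])
    have "1 - \<omega> z = 2 / (P z + 1)"
      using P1[OF zu] by (simp add: \<omega>_def field_simps)
    then have "2 * \<delta> * \<omega> z / (1 - \<omega> z) = \<delta> * (P z - 1)"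
      using P1[OF zu] by (simp add: \<omega>_def)
    also have "\<dots> = z * (\<gamma> * L' z)"
      using m E by (simp add: \<delta>_def P_def)
    finally show "z * (\<gamma> * L' z) = 2 * \<delta> * \<omega> z / (1 - \<omega> z)" ..
  next
    show "continuous_on (ball 0 1) (\<lambda>z. \<gamma> * L' z)"
      using holomorphic_on_imp_continuous_on[OF holL'] by (auto intro!: continuous_intros simp: unit_disk_def)
    show "exp (\<gamma> * log_quot f 0) = 1"
      by (simp add: L)
    have "cmod \<delta> = cmod \<gamma> * m"
      using m E by (simp add: \<delta>_def norm_mult norm_divide)
    also have "\<dots> \<le> cmod \<gamma> * (1 - lam)"
      using lam by (intro mult_left_mono) (auto simp: m_def mult_left_le)
    also have "\<dots> < 1/2"
      using \<gamma> lam by (simp add: field_simps)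
    finally show "cmod \<delta> < 1/2" .
  qed
  show ?thesis
    using inj_on_disc by (simp add: unit_disk_def)
qed

text \<open>As an integral over [0, 1] with parameters, \<open>J_op\<close> is jointly continuous in
  exponent and point, hence uniformly continuous on a compact product. This supplies the convergence
  for Hurwitz' theorem.\<close>

lemma uniform_limit_J_op:
  assumes L: "log_quot f holomorphic_on unit_disk" and K: "compact K" "K \<subseteq> unit_disk"
    and \<gamma>: "\<gamma>s \<longlonglongrightarrow> \<gamma>"
  shows "uniform_limit K (\<lambda>n. J_op (\<gamma>s n) f) (J_op \<gamma> f) sequentially"
proof -
  define \<Gamma> where "\<Gamma> = closure (range \<gamma>s)"
  have "bounded (range \<gamma>s)"
    using \<gamma> convergent_imp_bounded by blast
  then have comp: "compact (\<Gamma> \<times> K)"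
    by (intro compact_Times K) (simp add: \<Gamma>_def compact_closure)
  have mem: "\<gamma>s n \<in> \<Gamma>" for n
    using closure_subset[of "range \<gamma>s"] by (auto simp: \<Gamma>_def)
  then have mem': "\<gamma> \<in> \<Gamma>"
    using closed_sequentially[OF closed_closure _ \<gamma>, of "range \<gamma>s"] by (simp add: \<Gamma>_def)
  define \<Phi> where "\<Phi> = (\<lambda>t. integral (cbox 0 1) (\<lambda>u. exp (fst t * log_quot f (of_real u * snd t)) * snd t))"
  have contL: "continuous_on unit_disk (log_quot f)"
    using L by (rule holomorphic_on_imp_continuous_on)
  have seg: "of_real u * z \<in> unit_disk" if "z \<in> K" "0 \<le> u" "u \<le> 1" for u :: real and z
  proof -
    have "cmod z < 1"
      using K(2) that by (auto simp: unit_disk_def)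
    then show ?thesis
      using that by (simp add: unit_disk_def norm_mult mult_le_one) (smt (verit) mult_left_le_one_le norm_ge_zero)
  qed
  have "continuous_on (\<Gamma> \<times> K) \<Phi>"
    unfolding \<Phi>_def
    by (rule integral_continuous_on_param)
      (auto intro!: continuous_intros continuous_on_compose2[OF contL] seg simp: split_beta)
  then have unif: "uniformly_continuous_on (\<Gamma> \<times> K) \<Phi>"
    using comp by (rule compact_uniformly_continuous)
  have \<Phi>: "J_op c f z = \<Phi> (c, z)" for c z
    by (simp add: J_op_def \<Phi>_def contour_integral_integral linepath_def scaleR_conv_of_real)
  show ?thesis
  proof (rule uniform_limitI)
    fix e :: real assume "e > 0"
    then obtain d where d: "d > 0"
      "\<And>t t'. t \<in> \<Gamma> \<times> K \<Longrightarrow> t' \<in> \<Gamma> \<times> K \<Longrightarrow> dist t' t < d \<Longrightarrow> dist (\<Phi> t') (\<Phi> t) < e"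
      using unif unfolding uniformly_continuous_on_def by metis
    have "\<forall>\<^sub>F n in sequentially. dist (\<gamma>s n) \<gamma> < d"
      using \<gamma> d(1) by (rule tendstoD)
    then show "\<forall>\<^sub>F n in sequentially. \<forall>z\<in>K. dist (J_op (\<gamma>s n) f z) (J_op \<gamma> f z) < e"
      by eventually_elim (auto simp: \<Phi> dist_Pair_Pair intro!: d(2) mem mem')
  qed
qed

lemma J_op_in_classS:
  assumes lam: "lam < 1" and f: "f \<in> S_lambda lam" and \<gamma>: "cmod \<gamma> \<le> 1 / (2 * (1 - lam))"
  shows "J_op \<gamma> f \<in> classS"
proof -
  obtain \<alpha> where \<alpha>: "\<alpha> \<in> {-(pi/2)<..<pi/2}" and f\<alpha>: "f \<in> spiral_class \<alpha> lam"
    using f by (auto simp: S_lambda_def)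
  have fA: "f \<in> classA" and nz: "\<forall>z\<in>unit_disk. z \<noteq> 0 \<longrightarrow> f z \<noteq> 0"
    using f\<alpha> by (auto simp: spiral_class_def)
  note L = log_quot[OF fA nz]
  note JA = J_op_in_classA[OF fA nz]
  \<comment> \<open>The offset 2 keeps the factor strictly between 0 and 1 from n = 0 on, so these
    exponents lie in the open disc.\<close>
  define \<gamma>s where "\<gamma>s n = of_real (1 - 1 / (real n + 2)) * \<gamma>" for n
  have "(\<lambda>n. 1 - 1 / (real n + 2)) \<longlonglongrightarrow> 1"
    by real_asymp
  then have "\<gamma>s \<longlonglongrightarrow> of_real 1 * \<gamma>"
    unfolding \<gamma>s_def[abs_def] by (rule tendsto_mult_right[OF tendsto_of_real])
  then have lim: "\<gamma>s \<longlonglongrightarrow> \<gamma>"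
    by simp
  have "cmod (\<gamma>s n) < 1 / (2 * (1 - lam))" for n
  proof (cases "\<gamma> = 0")
    case False
    have "cmod (\<gamma>s n) = (1 - 1 / (real n + 2)) * cmod \<gamma>"
      unfolding \<gamma>s_def norm_mult norm_of_real by simp
    also have "\<dots> < cmod \<gamma>"
      using False by (simp add: mult_less_cancel_right1)
    finally show ?thesis
      using \<gamma> by simp
  qed (use lam in \<open>simp add: \<gamma>s_def\<close>)
  then have inj: "inj_on (J_op (\<gamma>s n) f) unit_disk" for n
    by (rule inj_on_J_op_less[OF lam \<alpha> f\<alpha>])
  have nonconst: "\<not> J_op \<gamma> f constant_on unit_disk"
  proof
    assume "J_op \<gamma> f constant_on unit_disk"
    then obtain c where c: "\<forall>z\<in>unit_disk. J_op \<gamma> f z = c"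
      unfolding constant_on_def by blast
    have "(J_op \<gamma> f has_field_derivative 0) (at 0)"
      by (rule has_field_derivative_transform_within_open[OF DERIV_const[of c] unit_disk_simps(1,3)])
        (use c in simp)
    then have "deriv (J_op \<gamma> f) 0 = 0"
      by (rule DERIV_imp_deriv)
    then show False
      using JA[of \<gamma>] by (simp add: classA_def)
  qed
  have hol: "J_op c f holomorphic_on unit_disk" for c
    using JA[of c] by (simp add: classA_def)
  have "inj_on (J_op \<gamma> f) unit_disk"
    by (rule Hurwitz_injective[OF unit_disk_simps(1) convex_connected[OF unit_disk_simps(2)] hol hol
          uniform_limit_J_op[OF L(1) _ _ lim] nonconst inj])
  then show ?thesis
    using JA[of \<gamma>] by (simp add: classS_def)
qed

section \<open>Failure of univalence outside\<close>

lemma Re_one_minus_pos: "cmod z < 1 \<Longrightarrow> 0 < Re (1 - z)"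
  using complex_Re_le_cmod[of z] by simp

lemma DERIV_Ln_one_minus:
  assumes "cmod z < 1"
  shows "((\<lambda>z. Ln (1 - z)) has_field_derivative - 1 / (1 - z)) (at z)"
proof -
  have "1 - z \<notin> \<real>\<^sub>\<le>\<^sub>0"
    using Re_one_minus_pos[OF assms] complex_nonpos_Reals_iff[of "1 - z"] by linarith
  then show ?thesis
    by (auto intro!: derivative_eq_intros simp: inverse_eq_divide)
qed

text \<open>The points are chosen with logarithms v - M and -v - M, whose difference is
  2\<pi>\<i>/c. The two hypotheses say |2 Re c| < |c|^2, that is |Im v| < \<pi>/2, so a shift far to
  the left brings both into the image of the disc under Ln (1 - z).\<close>

lemma powr_one_minus_not_inj:
  fixes c :: complex
  assumes c: "1 < cmod (c - 1)" "1 < cmod (c + 1)"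
  obtains z1 z2 where "cmod z1 < 1" "cmod z2 < 1" "z1 \<noteq> z2"
    "exp (c * Ln (1 - z1)) = exp (c * Ln (1 - z2))"
proof -
  have c0: "c \<noteq> 0"
    using c by auto
  define v where "v = \<i> * of_real pi / c"
  have pos: "(cmod c)\<^sup>2 > 0"
    using c0 by simp
  have "1\<^sup>2 < (cmod (c - 1))\<^sup>2" "1\<^sup>2 < (cmod (c + 1))\<^sup>2"
    using c by (intro power_strict_mono; simp)+
  then have "\<bar>2 * Re c\<bar> < (cmod c)\<^sup>2"
    unfolding cmod_power2 by (simp add: power2_eq_square algebra_simps abs_less_iff)
  then have "\<bar>Re c / (cmod c)\<^sup>2\<bar> < 1/2"
    using pos by (simp add: abs_divide abs_mult pos_divide_less_eq)
  then have "pi * \<bar>Re c / (cmod c)\<^sup>2\<bar> < pi * (1/2)"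
    by (intro mult_strict_left_mono) auto
  moreover have "Im v = pi * (Re c / (cmod c)\<^sup>2)"
    by (simp add: v_def Im_divide cmod_power2)
  ultimately have Imv: "\<bar>Im v\<bar> < pi / 2"
    by (simp add: abs_mult)
  then have cosv: "0 < cos (Im v)"
    by (intro cos_gt_zero_pi) auto
  \<comment> \<open>This makes r = |exp (w - M)| at most cos (Im v), whence |1 - exp (w - M)|^2 = 1
    - 2r cos (Im v) + r^2 < 1.\<close>
  define M where "M = \<bar>Re v\<bar> - ln (cos (Im v))"
  have half: "cmod (1 - exp (w - of_real M)) < 1 \<and> Ln (1 - (1 - exp (w - of_real M))) = w - of_real M"
    if w: "w = v \<or> w = - v" for w
  proof
    have Imw: "\<bar>Im w\<bar> < pi / 2" "cos (Im w) = cos (Im v)" "Re w \<le> \<bar>Re v\<bar>"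
      using w Imv by auto
    define r where "r = exp (Re w - M)"
    have "r \<le> exp (ln (cos (Im v)))"
      unfolding r_def using Imw(3) by (simp add: M_def del: exp_ln_iff)
    then have r: "0 < r" "r \<le> cos (Im v)"
      using cosv by (auto simp: r_def)
    have "(Re (exp (w - of_real M)))\<^sup>2 + (Im (exp (w - of_real M)))\<^sup>2 = r\<^sup>2"
      using cmod_power2[of "exp (w - of_real M)"] by (simp add: r_def)
    moreover have "Re (exp (w - of_real M)) = r * cos (Im v)"
      by (simp add: Re_exp r_def Imw(2))
    ultimately have "(cmod (1 - exp (w - of_real M)))\<^sup>2 = 1 - 2 * (r * cos (Im v)) + r\<^sup>2"
      unfolding cmod_power2 by (simp add: power2_eq_square algebra_simps)
    also have "\<dots> < 1"
    proof -
      have "r * r \<le> r * cos (Im v)" "0 < r * cos (Im v)"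
        using r cosv by auto
      then show ?thesis
        by (simp add: power2_eq_square)
    qed
    finally show "cmod (1 - exp (w - of_real M)) < 1"
      by (simp add: abs_square_less_1)
    show "Ln (1 - (1 - exp (w - of_real M))) = w - of_real M"
      using Imw(1) by (simp add: Ln_exp abs_less_iff)
  qed
  show ?thesis
  proof
    show "cmod (1 - exp (v - of_real M)) < 1" "cmod (1 - exp (- v - of_real M)) < 1"
      using half by auto
    have L: "Ln (1 - (1 - exp (v - of_real M))) = v - of_real M"
      "Ln (1 - (1 - exp (- v - of_real M))) = - v - of_real M"
      using half by blast+
    have "v \<noteq> 0"
      using c0 by (simp add: v_def)
    show "1 - exp (v - of_real M) \<noteq> 1 - exp (- v - of_real M)"
    proof
      assume eq: "1 - exp (v - of_real M) = 1 - exp (- v - of_real M)"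
      have "v - of_real M = - v - of_real M"
        by (rule trans[OF L(1)[symmetric, unfolded eq] L(2)])
      then show False
        using \<open>v \<noteq> 0\<close> by simp
    qed
    have "c * (v - of_real M) = c * (- v - of_real M) + 2 * of_real pi * \<i>"
      using c0 by (simp add: v_def algebra_simps)
    then show "exp (c * Ln (1 - (1 - exp (v - of_real M)))) = exp (c * Ln (1 - (1 - exp (- v - of_real M))))"
      unfolding L by (simp add: exp_add)
  qed
qed

text \<open>The factor exp (-\<i>\<alpha>) in \<beta> makes exp (\<i>\<alpha>)\<beta> real and
  positive, so the spiral condition reduces to Re (z/(1 - z)) > -1/2.\<close>

lemma spiral_extremal:
  fixes lam \<alpha> :: real
  assumes lam: "lam < 1" and \<alpha>: "\<alpha> \<in> {-(pi/2)<..<pi/2}"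
  defines "\<beta> \<equiv> 2 * of_real ((1 - lam) * cos \<alpha>) * exp (- (\<i> * of_real \<alpha>))"
  defines "f \<equiv> \<lambda>z. z * exp (- \<beta> * Ln (1 - z))"
  shows "f \<in> spiral_class \<alpha> lam"
    and "\<And>z. z \<in> unit_disk \<Longrightarrow> log_quot f z = - \<beta> * Ln (1 - z)"
proof -
  have cos: "cos \<alpha> > 0"
    using \<alpha> by (intro cos_gt_zero_pi) auto
  have k': "((\<lambda>z. - \<beta> * Ln (1 - z)) has_field_derivative \<beta> / (1 - z)) (at z)" if "z \<in> unit_disk" for z
    using DERIV_cmult[OF DERIV_Ln_one_minus, of z "- \<beta>"] that by (simp add: unit_disk_def)
  have f': "(f has_field_derivative exp (- \<beta> * Ln (1 - z)) * (1 + \<beta> * z / (1 - z))) (at z)"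
    if "z \<in> unit_disk" for z
  proof -
    have "(f has_field_derivative 1 * exp (- \<beta> * Ln (1 - z))
        + exp (- \<beta> * Ln (1 - z)) * (\<beta> / (1 - z)) * z) (at z)"
      unfolding f_def by (rule DERIV_mult[OF DERIV_ident DERIV_chain2[OF DERIV_exp k'[OF that]]])
    then show ?thesis
      by (simp add: algebra_simps)
  qed
  have "f holomorphic_on unit_disk"
    using f' holomorphic_on_open[of unit_disk f] by auto
  moreover have "deriv f 0 = 1"
    using DERIV_imp_deriv[OF f'[of 0]] by simp
  ultimately have fA: "f \<in> classA"
    by (simp add: classA_def f_def)
  have nz: "\<forall>z\<in>unit_disk. z \<noteq> 0 \<longrightarrow> f z \<noteq> 0"
    by (simp add: f_def)
  show "log_quot f z = - \<beta> * Ln (1 - z)" if "z \<in> unit_disk" for z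
  proof (rule log_quot_unique[OF fA nz _ _ _ that])
    show "(\<lambda>z. - \<beta> * Ln (1 - z)) holomorphic_on unit_disk"
      using k' holomorphic_on_open[of unit_disk "\<lambda>z. - \<beta> * Ln (1 - z)"] by auto
  qed (auto simp: quot_def f_def)
  have "Re (exp (\<i> * of_real \<alpha>) * z * deriv f z / f z) > lam * cos \<alpha>"
    if z: "z \<in> unit_disk" "z \<noteq> 0" for z
  proof -
    have "exp (\<i> * of_real \<alpha>) * \<beta> = of_real (2 * ((1 - lam) * cos \<alpha>))"
      by (simp add: \<beta>_def exp_minus)
    moreover have "exp (\<i> * of_real \<alpha>) * z * deriv f z / f z
        = exp (\<i> * of_real \<alpha>) + exp (\<i> * of_real \<alpha>) * \<beta> * (z / (1 - z))"
    proof -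
      have "z * deriv f z = f z * (1 + \<beta> * z / (1 - z))"
        unfolding DERIV_imp_deriv[OF f'[OF z(1)]] by (simp add: f_def)
      then show ?thesis
        using nz z by (simp add: mult.assoc distrib_left add_divide_distrib)
    qed
    ultimately have "exp (\<i> * of_real \<alpha>) * z * deriv f z / f z
        = exp (\<i> * of_real \<alpha>) + of_real (2 * ((1 - lam) * cos \<alpha>)) * (z / (1 - z))"
      by simp
    then have "Re (exp (\<i> * of_real \<alpha>) * z * deriv f z / f z)
        = cos \<alpha> + 2 * ((1 - lam) * cos \<alpha>) * Re (z / (1 - z))"
      by (simp add: Re_exp del: of_real_mult times_divide_eq_right)
    moreover have "Re (z / (1 - z)) > - (1/2)"
    proof -
      have "cmod z < 1"
        using z by (simp add: unit_disk_def)
      then have "1 < 2 * 1 * Re (1 / (1 - z))"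
        by (intro Re_inverse_gt_if_in_disc) simp
      moreover have "z / (1 - z) = 1 / (1 - z) - 1"
      proof -
        have "1 - z \<noteq> 0"
          using \<open>cmod z < 1\<close> by auto
        then show ?thesis
          by (simp add: field_simps)
      qed
      ultimately show ?thesis
        by simp
    qed
    then have "(1 - lam) * cos \<alpha> * (2 * Re (z / (1 - z))) > (1 - lam) * cos \<alpha> * (- 1)"
      using lam cos by (intro mult_strict_left_mono) auto
    ultimately show ?thesis
      by (simp add: algebra_simps)
  qed
  then show "f \<in> spiral_class \<alpha> lam"
    using fA nz by (simp add: spiral_class_def)
qed

text \<open>At the angles a and -a with cos a = 1/(2|\<Gamma>|) the point has modulus 1/2. The
  circles of radius 1/2 about 0 and 1 touch only at 1/2, so one of these two distinct points lies
  outside the closed disc about 1. Shrinking its angle slightly raises the modulus above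
  1/2.\<close>

lemma exists_rotated_outside_discs:
  fixes \<Gamma> :: complex
  assumes \<Gamma>: "1/2 < cmod \<Gamma>"
  obtains \<alpha> where "\<alpha> \<in> {-(pi/2)<..<pi/2}"
    "1/2 < cmod (\<Gamma> * (of_real (cos \<alpha>) * exp (- (\<i> * of_real \<alpha>))))"
    "1/2 < cmod (\<Gamma> * (of_real (cos \<alpha>) * exp (- (\<i> * of_real \<alpha>))) - 1)"
proof -
  define \<delta> where "\<delta> \<alpha> = \<Gamma> * (of_real (cos \<alpha>) * exp (- (\<i> * of_real \<alpha>)))" for \<alpha> :: real
  have norm_\<delta>: "cmod (\<delta> \<alpha>) = cmod \<Gamma> * \<bar>cos \<alpha>\<bar>" for \<alpha>
    by (simp add: \<delta>_def norm_mult)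
  define q where "q = 1 / (2 * cmod \<Gamma>)"
  have q: "0 < q" "q < 1" "cmod \<Gamma> * q = 1/2"
    using \<Gamma> by (auto simp: q_def divide_less_eq)
  define a where "a = arccos q"
  have a: "0 < a" "a < pi / 2" "cos a = q"
    using q arccos_lt_bounded[of q] arccos_less_arccos[of 0 q] by (auto simp: a_def cos_arccos)
  have "\<Gamma> \<noteq> 0"
    using \<Gamma> by auto
  have "\<delta> a \<noteq> \<delta> (- a)"
  proof
    assume "\<delta> a = \<delta> (- a)"
    then have "exp (- (\<i> * of_real a)) = exp (\<i> * of_real a)"
      using \<open>\<Gamma> \<noteq> 0\<close> a q by (simp add: \<delta>_def)
    then have "Im (exp (- (\<i> * of_real a))) = Im (exp (\<i> * of_real a))"
      by simp
    then have "sin a = 0"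
      by (simp add: Im_exp)
    then show False
      using sin_gt_zero[of a] a by simp
  qed
  then obtain \<sigma> where \<sigma>: "\<sigma> = a \<or> \<sigma> = - a" "\<delta> \<sigma> \<noteq> 1/2"
    by metis
  have norm_\<sigma>: "cmod (\<delta> \<sigma>) = 1/2"
    using \<sigma>(1) a(3) q \<Gamma> by (auto simp: norm_\<delta>)
  have "Re (\<delta> \<sigma>) < 1/2"
  proof (rule ccontr)
    assume "\<not> Re (\<delta> \<sigma>) < 1/2"
    then have re: "Re (\<delta> \<sigma>) = 1/2"
      using complex_Re_le_cmod[of "\<delta> \<sigma>"] norm_\<sigma> by simp
    have "Im (\<delta> \<sigma>) = 0"
      using cmod_power2[of "\<delta> \<sigma>"] unfolding norm_\<sigma> re by simp
    with re show False
      using \<sigma>(2) by (simp add: complex_eq_iff)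
  qed
  moreover have "(cmod (\<delta> \<sigma> - 1))\<^sup>2 = (cmod (\<delta> \<sigma>))\<^sup>2 + 1 - 2 * Re (\<delta> \<sigma>)"
    unfolding cmod_power2 by (simp add: power2_eq_square algebra_simps)
  ultimately have "(1/2)\<^sup>2 < (cmod (\<delta> \<sigma> - 1))\<^sup>2"
    unfolding norm_\<sigma> by simp
  then have far: "1/2 < cmod (\<delta> \<sigma> - 1)"
    by (rule power2_less_imp_less) simp
  \<comment> \<open>Lying outside the disc about 1 is an open condition, so it survives scaling the
    angle by some t < 1 close to 1.\<close>
  have "continuous (at_left 1) (\<lambda>t. cmod (\<delta> (t * \<sigma>) - 1))"
    unfolding \<delta>_def by (intro continuous_intros)
  then have "((\<lambda>t. cmod (\<delta> (t * \<sigma>) - 1)) \<longlongrightarrow> cmod (\<delta> (1 * \<sigma>) - 1)) (at_left 1)"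
    by (simp add: continuous_within)
  then have "\<forall>\<^sub>F t in at_left 1. 1/2 < cmod (\<delta> (t * \<sigma>) - 1)"
    by (rule order_tendstoD) (use far in simp)
  moreover have "\<forall>\<^sub>F t in at_left (1::real). t \<in> {0<..<1}"
    by (rule eventually_at_left_real) simp
  ultimately have "\<forall>\<^sub>F t in at_left 1. 1/2 < cmod (\<delta> (t * \<sigma>) - 1) \<and> t \<in> {0<..<1}"
    by (rule eventually_conj)
  then have "\<exists>t. 1/2 < cmod (\<delta> (t * \<sigma>) - 1) \<and> t \<in> {0<..<1}"
    by (rule eventually_happens'[rotated]) simp
  then obtain t where t: "1/2 < cmod (\<delta> (t * \<sigma>) - 1)" "0 < t" "t < 1"
    by auto
  have ta: "0 < t * a" "t * a < a"
    using t a by auto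
  have "cos a < cos (t * a)"
    using ta a by (intro cos_monotone_0_pi) auto
  moreover have "cos (t * \<sigma>) = cos (t * a)"
    using \<sigma>(1) by auto
  ultimately have "cmod \<Gamma> * cos a < cmod \<Gamma> * \<bar>cos (t * \<sigma>)\<bar>"
    using \<Gamma> by (intro mult_strict_left_mono) auto
  then have "1/2 < cmod (\<delta> (t * \<sigma>))"
    using a(3) q(3) by (simp add: norm_\<delta>)
  moreover have "t * \<sigma> \<in> {-(pi/2)<..<pi/2}"
    using \<sigma>(1) ta(1) less_trans[OF ta(2) a(2)] by auto
  ultimately show ?thesis
    using that[of "t * \<sigma>"] t(1) by (simp add: \<delta>_def)
qed

lemma J_op_not_in_classS:
  assumes lam: "lam < 1" and \<gamma>: "1 / (2 * (1 - lam)) < cmod \<gamma>"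
  shows "\<exists>f\<in>S_lambda lam. J_op \<gamma> f \<notin> classS"
proof -
  have "cmod (\<gamma> * of_real (1 - lam)) = cmod \<gamma> * (1 - lam)"
    using lam unfolding norm_mult norm_of_real by simp
  then have "1/2 < cmod (\<gamma> * of_real (1 - lam))"
    using \<gamma> lam by (simp add: field_simps)
  then obtain \<alpha> where \<alpha>: "\<alpha> \<in> {-(pi/2)<..<pi/2}"
    "1/2 < cmod (\<gamma> * of_real (1 - lam) * (of_real (cos \<alpha>) * exp (- (\<i> * of_real \<alpha>))))"
    "1/2 < cmod (\<gamma> * of_real (1 - lam) * (of_real (cos \<alpha>) * exp (- (\<i> * of_real \<alpha>))) - 1)"
    by (rule exists_rotated_outside_discs)
  define \<beta> where "\<beta> = 2 * complex_of_real ((1 - lam) * cos \<alpha>) * exp (- (\<i> * of_real \<alpha>))"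
  define f where "f = (\<lambda>z. z * exp (- \<beta> * Ln (1 - z)))"
  have f: "f \<in> spiral_class \<alpha> lam" and logf: "\<And>z. z \<in> unit_disk \<Longrightarrow> log_quot f z = - \<beta> * Ln (1 - z)"
    using spiral_extremal[OF lam \<alpha>(1)] by (simp_all add: f_def \<beta>_def)
  have fA: "f \<in> classA" and nz: "\<forall>z\<in>unit_disk. z \<noteq> 0 \<longrightarrow> f z \<noteq> 0"
    using f by (auto simp: spiral_class_def)
  note L = log_quot[OF fA nz]
  \<comment> \<open>With \<gamma>\<beta> = 2\<delta>, the quantities |c - 1| and |c + 1| are
    2|\<delta>| and 2|\<delta> - 1|, so the choice of \<alpha> matches
    \<open>powr_one_minus_not_inj\<close>.\<close>
  define c where "c = 1 - \<gamma> * \<beta>"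
  have \<beta>: "\<gamma> * \<beta> = 2 * (\<gamma> * of_real (1 - lam) * (of_real (cos \<alpha>) * exp (- (\<i> * of_real \<alpha>))))"
    by (simp add: \<beta>_def)
  have "1 < cmod (\<gamma> * \<beta>)"
    unfolding \<beta> using \<alpha>(2) by (subst norm_mult) simp
  then have c1: "1 < cmod (c - 1)"
    by (simp add: c_def)
  have "\<gamma> * \<beta> - 2 = 2 * (\<gamma> * of_real (1 - lam) * (of_real (cos \<alpha>) * exp (- (\<i> * of_real \<alpha>))) - 1)"
    unfolding \<beta> by (simp add: algebra_simps)
  then have "1 < cmod (\<gamma> * \<beta> - 2)"
    using \<alpha>(3) by (simp only: norm_mult) simp
  then have c2: "1 < cmod (c + 1)"
    by (simp add: c_def norm_minus_commute)
  have c0: "c \<noteq> 0"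
    using c1 by auto
  have J: "J_op \<gamma> f z = (1 - exp (c * Ln (1 - z))) / c" if z: "z \<in> unit_disk" for z
  proof (rule DERIV_unique_primitive[where S = unit_disk and a = 0 and F = "J_op \<gamma> f"
        and h = "\<lambda>z. exp (\<gamma> * log_quot f z)" and G = "\<lambda>z. (1 - exp (c * Ln (1 - z))) / c"])
    show "J_op \<gamma> f 0 = (1 - exp (c * Ln (1 - 0))) / c"
      by (simp add: J_op_0[OF L(1)])
    fix x assume x: "x \<in> unit_disk"
    show "(J_op \<gamma> f has_field_derivative exp (\<gamma> * log_quot f x)) (at x)"
      by (rule DERIV_J_op[OF L(1) x])
    have x1: "cmod x < 1" "1 - x \<noteq> 0"
      using x by (auto simp: unit_disk_def)
    have "((\<lambda>z. (1 - exp (c * Ln (1 - z))) / c) has_field_derivative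
        (0 - exp (c * Ln (1 - x)) * (c * (- 1 / (1 - x)))) / c) (at x)"
      by (rule DERIV_cdivide[OF DERIV_diff[OF DERIV_const
            DERIV_chain2[OF DERIV_exp DERIV_cmult[OF DERIV_Ln_one_minus[OF x1(1)]]]]])
    moreover have "(0 - exp (c * Ln (1 - x)) * (c * (- 1 / (1 - x)))) / c = exp (c * Ln (1 - x)) / (1 - x)"
      using c0 by simp
    moreover have "exp (c * Ln (1 - x)) / (1 - x) = exp (\<gamma> * log_quot f x)"
    proof -
      have "c * Ln (1 - x) = Ln (1 - x) + \<gamma> * log_quot f x"
        by (simp add: logf[OF x] c_def algebra_simps)
      then show ?thesis
        using x1(2) by (simp add: exp_add)
    qed
    ultimately show "((\<lambda>z. (1 - exp (c * Ln (1 - z))) / c) has_field_derivative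
        exp (\<gamma> * log_quot f x)) (at x)"
      by simp
  qed (use z in auto)
  obtain z1 z2 where z: "cmod z1 < 1" "cmod z2 < 1" "z1 \<noteq> z2"
    "exp (c * Ln (1 - z1)) = exp (c * Ln (1 - z2))"
    using powr_one_minus_not_inj[OF c1 c2] .
  have "\<not> inj_on (J_op \<gamma> f) unit_disk"
  proof
    assume inj: "inj_on (J_op \<gamma> f) unit_disk"
    have zu: "z1 \<in> unit_disk" "z2 \<in> unit_disk"
      using z by (auto simp: unit_disk_def)
    then have "J_op \<gamma> f z1 = J_op \<gamma> f z2"
      by (simp add: J z(4))
    then show False
      using inj_onD[OF inj] zu z(3) by blast
  qed
  then have "J_op \<gamma> f \<notin> classS"
    by (simp add: classS_def)
  then show ?thesis
    using f \<alpha>(1) by (auto simp: S_lambda_def)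
qed

theorem theorem2p4:
  fixes lam :: real
  assumes "lam < 1"
  shows "{\<gamma>::complex. \<forall>f\<in>S_lambda lam. J_op \<gamma> f \<in> classS}
           = {\<gamma>. cmod \<gamma> \<le> 1 / (2 * (1 - lam))}"
proof -
  have "(\<forall>f\<in>S_lambda lam. J_op \<gamma> f \<in> classS) \<longleftrightarrow> cmod \<gamma> \<le> 1 / (2 * (1 - lam))" for \<gamma>
    using J_op_in_classS[OF assms] J_op_not_in_classS[OF assms, of \<gamma>] by (meson not_le)
  then show ?thesis
    by blast
qed

end
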